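(* Let $r$ and $n$ be positive integers and let $\omega$ be a primitive $r$th root of $1$. Let $0\le b\le r-1$ be an integer and let $\mathbf H=(H_1,\dots,H_{2n})$ be a $2n$-tuple of non-empty subsets of $\mathbb Z_r$. Let $\mathbf S=(S_1,\dots,S_n)$ be given by $S_i=H_{2i-1}\cap H_{2i}$ for $1\le i\le n$. Then $$\sum_{\pi\in G_{r,2n}(\mathbf H)} \chi_{1,b}(\pi)\,t^{\mathrm{fdes}(\pi)}q^{\mathrm{fmaj}(\pi)}\prod_{i=1}^{2n}x_i^{z_i} = \prod_{i=1}^{n}\left(1-t^rq^{r(2i-1)}\right)\sum_{\pi\in G_{r,n}(\mathbf S)}t^{\mathrm{fdes}(\pi)}(\omega^bq)^{2\,\mathrm{fmaj}(\pi)}\prod_{i=1}^{n}(x_{2i-1}x_{2i})^{z_i}.$$ In particular, $$\sum_{\pi\in G_{r,2n}} \chi_{1,b}(\pi)\,t^{\mathrm{fdes}(\pi)}q^{\mathrm{fmaj}(\pi)}x^{\mathrm{col}(\pi)} = \prod_{i=1}^{n}\left(1-t^rq^{r(2i-1)}\right)\sum_{\pi\in G_{r,n}}t^{\mathrm{fdes}(\pi)}(\omega^bq)^{2\,\mathrm{fmaj}(\pi)}x^{2\,\mathrm{col}(\pi)}.$$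
   Context: Here $t,q,x,x_1,x_2,\dots$ are commuting indeterminates. For positive integers $r,N$, $G_{r,N}=\mathbb{Z}_r\wr\mathfrak{S}_N$ is the group of colored permutations: its elements are pairs $\pi=(\sigma,\mathbf z)$ with $\sigma=\sigma_1\cdots\sigma_N\in\mathfrak S_N$ and $\mathbf z=(z_1,\dots,z_N)$, where each color $z_i\in\mathbb Z_r$ is represented by an integer in $\{0,1,\dots,r-1\}$. One writes $\pi=\pi_1\pi_2\cdots\pi_N$ with $\pi_i=\sigma_i^{[z_i]}$ (superscript $[0]$ omitted). In sums over $\pi=(\sigma,\mathbf z)$, $z_i$ denotes the $i$-th color of $\pi$. Restricted colored permutations: for an $N$-tuple $\mathbf S=(S_1,\dots,S_N)$ of subsets of $\mathbb Z_r$, $G_{r,N}(\mathbf S)=\{(\sigma,\mathbf z)\in G_{r,N}: z_i\in S_i\text{ for all }i\}$; this is empty if some $S_i=\emptyset$. Color sum: $\mathrm{col}(\pi)=\sum_{i=1}^N z_i$ (an integer). Length: $\ell(\pi)=\mathrm{inv}(\pi)+\sum_{i:\,z_i>0}(\sigma_i+z_i-1)$, where $\mathrm{inv}(\pi)=|\{(i,j): i<j,\ \pi_i>\pi_j\}|$ is computed with respect to the linear order $N^{[r-1]}<\cdots<N^{[1]}<\cdots<1^{[r-1]}<\cdots<1^{[1]}<1<\cdots<N$. One-dimensional characters: $\chi_{a,b}(\pi)=(-1)^{a(\ell(\pi)-\mathrm{col}(\pi))}\omega^{b\,\mathrm{col}(\pi)}$ for $a\in\{0,1\}$, $0\le b\le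 r-1$. Flag statistics: $\mathrm{Des}_F(\pi)=\{i\in\{1,\dots,N-1\}:\pi_i>\pi_{i+1}\}$ with respect to the (different) linear order $1^{[r-1]}<\cdots<N^{[r-1]}<\cdots<1^{[1]}<\cdots<N^{[1]}<1<\cdots<N$; $\mathrm{des}_F(\pi)=|\mathrm{Des}_F(\pi)|$, $\mathrm{maj}_F(\pi)=\sum_{i\in\mathrm{Des}_F(\pi)}i$, $\mathrm{fdes}(\pi)=r\cdot\mathrm{des}_F(\pi)+z_1$, and $\mathrm{fmaj}(\pi)=r\cdot\mathrm{maj}_F(\pi)+\mathrm{col}(\pi)$. *)

theory Defs
  imports Complex_Main "HOL-Library.Poly_Mapping" "HOL-Library.FuncSet"
    "HOL-Combinatorics.Permutations"
begin

section \<open>Polynomials in the indeterminates t, q, x, x_1, x_2, ...\<close>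

datatype indet = T | Q | X | Xi nat

text \<open>A monomial is a finitely supported exponent vector, and a polynomial is a finitely supported
  family of complex coefficients indexed by monomials; multiplication is the convolution product
  of \<^theory>\<open>HOL-Library.Poly_Mapping\<close>.\<close>

type_synonym cpoly = "(indet \<Rightarrow>\<^sub>0 nat) \<Rightarrow>\<^sub>0 complex"

definition Var :: "indet \<Rightarrow> cpoly" where
  "Var v = Poly_Mapping.single (Poly_Mapping.single v 1) 1"

definition Const :: "complex \<Rightarrow> cpoly" where
  "Const c = Poly_Mapping.single 0 c"

definition primitive_root_of_1 :: "nat \<Rightarrow> complex \<Rightarrow> bool" where
  "primitive_root_of_1 r w \<longleftrightarrow> w ^ r = 1 \<and> (\<forall>k. 0 < k \<and> k < r \<longrightarrow> w ^ k \<noteq> 1)"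


section \<open>Colored permutations\<close>

text \<open>A colored permutation of size \<open>N\<close> is a pair \<open>(\<sigma>, z)\<close>, where \<open>\<sigma>\<close> is a permutation of \<open>{1..N}\<close>
  and \<open>z\<close> assigns to each position in \<open>{1..N}\<close> a color. The elements of \<open>\<int>\<^sub>r\<close> are represented by
  the numbers in \<open>{..<r}\<close>. Outside \<open>{1..N}\<close>, \<open>\<sigma>\<close> is the identity and \<open>z\<close> is \<open>undefined\<close>, so
  that each colored permutation is represented exactly once.\<close>

type_synonym colored_perm = "(nat \<Rightarrow> nat) \<times> (nat \<Rightarrow> nat)"

definition colored_perms :: "nat \<Rightarrow> nat \<Rightarrow> colored_perm set" where
  "colored_perms r N = {\<sigma>. \<sigma> permutes {1..N}} \<times> ({1..N} \<rightarrow>\<^sub>E {..<r})"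

definition restricted_colored_perms ::
    "nat \<Rightarrow> nat \<Rightarrow> (nat \<Rightarrow> nat set) \<Rightarrow> colored_perm set" where
  "restricted_colored_perms r N S = {(\<sigma>, z) \<in> colored_perms r N. \<forall>i\<in>{1..N}. z i \<in> S i}"

text \<open>The \<open>i\<close>-th letter of \<open>\<pi>\<close>; the pair \<open>(k, c)\<close> stands for \<open>k\<close> with color \<open>c\<close>.\<close>

definition letter :: "colored_perm \<Rightarrow> nat \<Rightarrow> nat \<times> nat" where
  "letter \<pi> i = (fst \<pi> i, snd \<pi> i)"

definition color :: "colored_perm \<Rightarrow> nat \<Rightarrow> nat" where
  "color \<pi> i = snd \<pi> i"

definition col :: "nat \<Rightarrow> colored_perm \<Rightarrow> nat" where
  "col N \<pi> = (\<Sum>i=1..N. color \<pi> i)"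

text \<open>The order \<open>N\<^bsup>[r-1]\<^esup> < \<dots> < N\<^bsup>[1]\<^esup> < \<dots> < 1\<^bsup>[r-1]\<^esup> < \<dots> < 1\<^bsup>[1]\<^esup> < 1 < \<dots> < N\<close>.\<close>

definition length_less :: "nat \<times> nat \<Rightarrow> nat \<times> nat \<Rightarrow> bool" where
  "length_less = (\<lambda>(k, c) (l, d).
     if c = 0 then d = 0 \<and> k < l
     else d = 0 \<or> l < k \<or> (k = l \<and> d < c))"

text \<open>The order \<open>1\<^bsup>[r-1]\<^esup> < \<dots> < N\<^bsup>[r-1]\<^esup> < \<dots> < 1\<^bsup>[1]\<^esup> < \<dots> < N\<^bsup>[1]\<^esup> < 1 < \<dots> < N\<close>.\<close>

definition flag_less :: "nat \<times> nat \<Rightarrow> nat \<times> nat \<Rightarrow> bool" where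
  "flag_less = (\<lambda>(k, c) (l, d). d < c \<or> (c = d \<and> k < l))"

definition inv_len :: "nat \<Rightarrow> colored_perm \<Rightarrow> nat" where
  "inv_len N \<pi> = card {(i, j). i \<in> {1..N} \<and> j \<in> {1..N} \<and> i < j \<and>
     length_less (letter \<pi> j) (letter \<pi> i)}"

text \<open>The subtraction is not truncated, since it occurs only for \<open>z\<^sub>i > 0\<close>.\<close>

definition len :: "nat \<Rightarrow> colored_perm \<Rightarrow> nat" where
  "len N \<pi> = inv_len N \<pi> + (\<Sum>i | i \<in> {1..N} \<and> color \<pi> i > 0. fst \<pi> i + color \<pi> i - 1)"

definition DesF :: "nat \<Rightarrow> colored_perm \<Rightarrow> nat set" where
  "DesF N \<pi> = {i \<in> {1..N - 1}. flag_less (letter \<pi> (i + 1)) (letter \<pi> i)}"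

definition desF :: "nat \<Rightarrow> colored_perm \<Rightarrow> nat" where
  "desF N \<pi> = card (DesF N \<pi>)"

definition majF :: "nat \<Rightarrow> colored_perm \<Rightarrow> nat" where
  "majF N \<pi> = \<Sum>(DesF N \<pi>)"

definition fdes :: "nat \<Rightarrow> nat \<Rightarrow> colored_perm \<Rightarrow> nat" where
  "fdes r N \<pi> = r * desF N \<pi> + color \<pi> 1"

definition fmaj :: "nat \<Rightarrow> nat \<Rightarrow> colored_perm \<Rightarrow> nat" where
  "fmaj r N \<pi> = r * majF N \<pi> + col N \<pi>"

text \<open>By this lemma, the subtraction in the exponent of \<open>-1\<close> in
  the definition of \<open>chi\<close> below is not truncated.\<close>

lemma col_le_len:
  assumes "\<pi> \<in> colored_perms r N"
  shows "col N \<pi> \<le> len N \<pi>"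
proof -
  have perm: "fst \<pi> permutes {1..N}"
    using assms by (auto simp: colored_perms_def)
  have "col N \<pi> = (\<Sum>i | i \<in> {1..N} \<and> color \<pi> i > 0. color \<pi> i)"
    unfolding col_def by (rule sum.mono_neutral_right) auto
  also have "\<dots> \<le> (\<Sum>i | i \<in> {1..N} \<and> color \<pi> i > 0. fst \<pi> i + color \<pi> i - 1)"
  proof (rule sum_mono)
    fix i assume "i \<in> {i \<in> {1..N}. color \<pi> i > 0}"
    then have "fst \<pi> i \<in> {1..N}"
      using permutes_in_image[OF perm, of i] by blast
    then show "color \<pi> i \<le> fst \<pi> i + color \<pi> i - 1"
      by auto
  qed
  also have "\<dots> \<le> len N \<pi>"
    by (simp add: len_def)
  finally show ?thesis .
qed

definition chi :: "complex \<Rightarrow> nat \<Rightarrow> nat \<Rightarrow> nat \<Rightarrow> colored_perm \<Rightarrow> complex" where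
  "chi \<omega> N a b \<pi> = (-1) ^ (a * (len N \<pi> - col N \<pi>)) * \<omega> ^ (b * col N \<pi>)"

end

theory Submission
  imports Defs
begin

text \<open>
  The character \<open>\<chi>\<^sub>1\<^sub>,\<^sub>b\<close> is the sign of the underlying permutation \<open>\<sigma>\<close> times \<open>\<omega>\<close> to the
  power \<open>b\<close> times the color sum (\<open>even_len_minus_col_iff\<close>). Since \<open>\<omega>\<^sup>r = 1\<close>, the power of \<open>\<omega>\<close> is
  absorbed by replacing \<open>q\<close> with \<open>\<omega>\<^sup>b q\<close>, which leaves every \<open>q\<^sup>r\<close> unchanged. For a fixed color
  vector \<open>z\<close>, everything except the sign and the descent set of \<open>(\<sigma>, z)\<close> is then a constant, and
  the theorem reduces to the evaluation of the signed sum of \<open>\<Prod>i\<in>Des. w i\<close> over all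
  permutations \<open>\<sigma>\<close> of \<open>{1..2n}\<close>, for arbitrary weights \<open>w\<close> (\<open>signed_descent_sum\<close>).

  That sum is evaluated by a sign-reversing involution. Exchanging the values \<open>c\<close> and \<open>c + 1\<close>, with
  \<open>c\<close> odd, changes the sign of \<open>\<sigma>\<close>; it also preserves the descent set, unless \<open>c\<close> and \<open>c + 1\<close>
  stand at adjacent positions of equal color. Exchanging the values for the least \<open>c\<close> for which
  this exception does not occur cancels all permutations but those for which the exception occurs
  for all odd \<open>c\<close>. In these, the pairs \<open>{c, c + 1}\<close> tile the positions \<open>1, \<dots>, 2n\<close>, so they occupy
  the position pairs \<open>{2a - 1, 2a}\<close>. Hence there are none unless \<open>z\<^sub>2\<^sub>a\<^sub>-\<^sub>1 = z\<^sub>2\<^sub>a\<close> for all \<open>a\<close>,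
  which is where the intersections \<open>H\<^sub>2\<^sub>a\<^sub>-\<^sub>1 \<inter> H\<^sub>2\<^sub>a\<close> come from.

  A remaining permutation is given by a permutation \<open>\<tau>\<close> of the \<open>n\<close> blocks and the set \<open>E\<close> of the
  blocks that are written in decreasing order (\<open>bij_betw_inflate\<close>). Its sign is \<open>(-1)\<close> to the power
  \<open>|E|\<close>, because an inversion of \<open>\<tau>\<close> yields four inversions of \<open>\<sigma>\<close>. Its descents are \<open>2a - 1\<close> for
  \<open>a \<in> E\<close>, and \<open>2a\<close> for the descents \<open>a\<close> of \<open>\<tau>\<close>. The sum over \<open>E\<close> is the product of the factors
  \<open>1 - w (2a - 1)\<close>, and the sum over \<open>\<tau>\<close> is the sum on the right-hand side.
\<close>

section \<open>Inversions and the sign of a permutation\<close>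

definition inversions :: "nat \<Rightarrow> (nat \<Rightarrow> nat) \<Rightarrow> (nat \<times> nat) set" where
  "inversions N \<sigma> = {(i, j). i \<in> {1..N} \<and> j \<in> {1..N} \<and> i < j \<and> \<sigma> j < \<sigma> i}"

lemma finite_inversions [simp]: "finite (inversions N \<sigma>)"
  by (rule finite_subset[of _ "{1..N} \<times> {1..N}"]) (auto simp: inversions_def)

lemma transpose_Suc_less_iff:
  fixes a b c :: nat
  assumes "{a, b} \<noteq> {c, Suc c}"
  shows "transpose c (Suc c) a < transpose c (Suc c) b \<longleftrightarrow> a < b"
  using assms by (auto simp: transpose_def doubleton_eq_iff)

text \<open>
  Only the relative order of the two positions that hold \<open>c\<close> and \<open>c + 1\<close> changes, since no other
  value lies between these two.
\<close>

lemma card_inversions_transpose_if_less: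
  assumes \<sigma>: "\<sigma> permutes {1..N}" and c: "c \<in> {1..N}" "Suc c \<in> {1..N}"
    and less: "inv \<sigma> c < inv \<sigma> (Suc c)"
  shows "card (inversions N (transpose c (Suc c) \<circ> \<sigma>)) = Suc (card (inversions N \<sigma>))"
proof -
  let ?s = "transpose c (Suc c)" and ?p = "inv \<sigma> c" and ?q = "inv \<sigma> (Suc c)"
  have pq: "\<sigma> ?p = c" "\<sigma> ?q = Suc c" "?p \<in> {1..N}" "?q \<in> {1..N}"
    using permutes_inverses(1)[OF \<sigma>] permutes_in_image[OF permutes_inv[OF \<sigma>]] c by auto
  have inj: "\<sigma> i = \<sigma> j \<longleftrightarrow> i = j" for i j
    using permutes_inj[OF \<sigma>] by (auto dest: injD)
  have "(i, j) \<in> inversions N (?s \<circ> \<sigma>) \<longleftrightarrow> (i, j) \<in> insert (?p, ?q) (inversions N \<sigma>)" for i j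
  proof (cases "{\<sigma> i, \<sigma> j} = {c, Suc c}")
    case True
    then have "?p = i \<and> ?q = j \<or> ?q = i \<and> ?p = j"
      unfolding permutes_inv_eq[OF \<sigma>] by (simp add: doubleton_eq_iff)
    then show ?thesis
    proof (elim disjE conjE)
      assume "?p = i" "?q = j"
      then show ?thesis
        using pq less by (simp add: inversions_def)
    next
      assume "?q = i" "?p = j"
      then show ?thesis
        using pq less by (simp add: inversions_def)
    qed
  next
    case False
    then have "(i, j) \<noteq> (?p, ?q)"
      using pq by auto
    moreover have "?s (\<sigma> j) < ?s (\<sigma> i) \<longleftrightarrow> \<sigma> j < \<sigma> i"
      using False by (intro transpose_Suc_less_iff) (simp add: insert_commute)
    ultimately show ?thesis
      by (auto simp: inversions_def)
  qed
  then have "inversions N (?s \<circ> \<sigma>) = insert (?p, ?q) (inversions N \<sigma>)"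
    by auto
  moreover have "(?p, ?q) \<notin> inversions N \<sigma>"
    using pq by (simp add: inversions_def)
  ultimately show ?thesis
    by simp
qed

lemma neg_one_power_inversions_transpose:
  assumes \<sigma>: "\<sigma> permutes {1..N}" and c: "c \<in> {1..N}" "Suc c \<in> {1..N}"
  shows "(-1 :: 'a :: ring_1) ^ card (inversions N (transpose c (Suc c) \<circ> \<sigma>)) =
    - ((-1) ^ card (inversions N \<sigma>))"
proof (cases "inv \<sigma> c < inv \<sigma> (Suc c)")
  case True
  then show ?thesis
    using card_inversions_transpose_if_less[OF \<sigma> c] by simp
next
  case False
  let ?s = "transpose c (Suc c)"
  have s: "?s permutes {1..N}"
    using c by (rule permutes_swap_id)
  have "inv \<sigma> (Suc c) \<noteq> inv \<sigma> c"
    using permutes_inj[OF permutes_inv[OF \<sigma>]] by (metis injD n_not_Suc_n)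
  moreover have "inv (?s \<circ> \<sigma>) x = inv \<sigma> (?s x)" for x
    using permutes_inv_eq[OF permutes_compose[OF \<sigma> s]] permutes_inverses(1)[OF \<sigma>]
    by simp
  ultimately have "inv (?s \<circ> \<sigma>) c < inv (?s \<circ> \<sigma>) (Suc c)"
    using False by simp
  then have "card (inversions N (?s \<circ> (?s \<circ> \<sigma>))) = Suc (card (inversions N (?s \<circ> \<sigma>)))"
    by (rule card_inversions_transpose_if_less[OF permutes_compose[OF \<sigma> s] c])
  moreover have "?s \<circ> (?s \<circ> \<sigma>) = \<sigma>"
    by (simp add: fun_eq_iff)
  ultimately show ?thesis
    by simp
qed

text \<open>
  Summing over the unordered pairs allows the three counts that enter the length to be compared
  pair by pair.
\<close>

lemma sum_pairs_eq_sum_ordered_pairs: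
  fixes f :: "nat \<Rightarrow> nat \<Rightarrow> 'a :: comm_monoid_add"
  assumes "\<And>i. f i i = 0"
  shows "(\<Sum>i\<in>{1..N}. \<Sum>j\<in>{1..N}. f i j) =
    (\<Sum>(i, j) | i \<in> {1..N} \<and> j \<in> {1..N} \<and> i < j. f i j + f j i)"
proof -
  define P where "P = {(i, j). i \<in> {1..N} \<and> j \<in> {1..N} \<and> i < j}"
  have fin: "finite P"
    by (rule finite_subset[of _ "{1..N} \<times> {1..N}"]) (auto simp: P_def)
  have "(\<Sum>i\<in>{1..N}. \<Sum>j\<in>{1..N}. f i j) = (\<Sum>(i, j)\<in>{1..N} \<times> {1..N}. f i j)"
    by (rule sum.cartesian_product)
  also have "\<dots> = (\<Sum>(i, j)\<in>P \<union> prod.swap ` P. f i j)"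
  proof (rule sum.mono_neutral_right)
    show "\<forall>p\<in>{1..N} \<times> {1..N} - (P \<union> prod.swap ` P). (case p of (i, j) \<Rightarrow> f i j) = 0"
    proof
      fix p
      assume p: "p \<in> {1..N} \<times> {1..N} - (P \<union> prod.swap ` P)"
      then have "prod.swap p \<notin> P"
        by (metis DiffD2 UnI2 image_eqI swap_swap)
      with p have "fst p = snd p"
        by (cases p) (auto simp: P_def)
      then show "(case p of (i, j) \<Rightarrow> f i j) = 0"
        using assms by (simp add: case_prod_unfold)
    qed
  qed (auto simp: P_def)
  also have "\<dots> = (\<Sum>(i, j)\<in>P. f i j) + (\<Sum>(i, j)\<in>prod.swap ` P. f i j)"
    using fin by (intro sum.union_disjoint) (auto simp: P_def)
  also have "(\<Sum>(i, j)\<in>prod.swap ` P. f i j) = (\<Sum>(i, j)\<in>P. f j i)"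
    by (subst sum.reindex) (auto simp: case_prod_unfold)
  finally show ?thesis
    unfolding P_def[symmetric] by (simp add: sum.distrib case_prod_unfold)
qed

text \<open>
  A position \<open>j\<close> of nonzero color contributes \<open>\<sigma> j - 1\<close> to the difference of length and color sum,
  which is the number of positions with a value smaller than \<open>\<sigma> j\<close>. Thus \<open>\<ell> - col + inv(\<sigma>)\<close> is a
  sum of contributions of the pairs \<open>i < j\<close>. Each of them is even: this is checked in the
  four cases of which of the two colors are zero.
\<close>

lemma even_len_minus_col_iff:
  assumes \<sigma>: "\<sigma> permutes {1..N}"
  shows "even (len N (\<sigma>, z) - col N (\<sigma>, z)) \<longleftrightarrow> even (card (inversions N \<sigma>))"
proof -
  define P where "P = {(i, j). i \<in> {1..N} \<and> j \<in> {1..N} \<and> i < j}"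
  define Z where "Z = {j \<in> {1..N}. z j > 0}"
  \<comment> \<open>\<open>g i j\<close> records that position \<open>i\<close> is counted by the term \<open>\<sigma> j - 1\<close> of the length.\<close>
  define g where "g i j = (of_bool (z j > 0 \<and> \<sigma> i < \<sigma> j) :: nat)" for i j
  have fin: "finite P"
    by (rule finite_subset[of _ "{1..N} \<times> {1..N}"]) (auto simp: P_def)
  have card_P: "card {(i, j). i \<in> {1..N} \<and> j \<in> {1..N} \<and> i < j \<and> R i j} =
      (\<Sum>(i, j)\<in>P. of_bool (R i j))" for R :: "nat \<Rightarrow> nat \<Rightarrow> bool"
  proof -
    have "(\<Sum>(i, j)\<in>P. of_bool (R i j) :: nat) = card (P \<inter> {(i, j). R i j})"
      using fin by (simp add: case_prod_unfold)
    also have "P \<inter> {(i, j). R i j} = {(i, j). i \<in> {1..N} \<and> j \<in> {1..N} \<and> i < j \<and> R i j}"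
      by (auto simp: P_def)
    finally show ?thesis ..
  qed
  have pos: "\<sigma> j \<ge> 1" if "j \<in> Z" for j
    using permutes_in_image[OF \<sigma>, of j] that by (simp add: Z_def)
  have "col N (\<sigma>, z) = (\<Sum>j\<in>Z. z j)"
    unfolding col_def color_def Z_def by (rule sum.mono_neutral_cong_right) auto
  moreover have "len N (\<sigma>, z) = inv_len N (\<sigma>, z) + (\<Sum>j\<in>Z. (\<sigma> j - 1) + z j)"
  proof -
    have "(\<Sum>j\<in>Z. \<sigma> j + z j - 1) = (\<Sum>j\<in>Z. (\<sigma> j - 1) + z j)"
      by (rule sum.cong) (use pos in auto)
    then show ?thesis
      by (simp add: len_def color_def Z_def)
  qed
  ultimately have "len N (\<sigma>, z) - col N (\<sigma>, z) = inv_len N (\<sigma>, z) + (\<Sum>j\<in>Z. \<sigma> j - 1)"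
    by (simp add: sum.distrib)
  also have "(\<Sum>j\<in>Z. \<sigma> j - 1) = (\<Sum>j\<in>Z. \<Sum>i\<in>{1..N}. g i j)"
  proof (rule sum.cong)
    fix j assume j: "j \<in> Z"
    have "(\<Sum>i\<in>{1..N}. g i j) = (\<Sum>i\<in>{1..N}. of_bool (\<sigma> i < \<sigma> j))"
      using j by (simp add: g_def Z_def)
    also have "\<dots> = (\<Sum>k\<in>{1..N}. of_bool (k < \<sigma> j))"
      by (rule sum.reindex_bij_betw[OF permutes_imp_bij[OF \<sigma>], of "\<lambda>k. of_bool (k < \<sigma> j)"])
    also have "\<dots> = card ({1..N} \<inter> {k. k < \<sigma> j})"
      by simp
    also have "{1..N} \<inter> {k. k < \<sigma> j} = {1..<\<sigma> j}"
      using permutes_in_image[OF \<sigma>, of j] j by (auto simp: Z_def)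
    finally show "\<sigma> j - 1 = (\<Sum>i\<in>{1..N}. g i j)"
      by simp
  qed simp
  also have "\<dots> = (\<Sum>j\<in>{1..N}. \<Sum>i\<in>{1..N}. g i j)"
    by (rule sum.mono_neutral_left) (auto simp: g_def Z_def)
  also have "\<dots> = (\<Sum>i\<in>{1..N}. \<Sum>j\<in>{1..N}. g i j)"
    by (rule sum.swap)
  also have "\<dots> = (\<Sum>(i, j)\<in>P. g i j + g j i)"
    unfolding P_def by (rule sum_pairs_eq_sum_ordered_pairs) (simp add: g_def)
  finally have "len N (\<sigma>, z) - col N (\<sigma>, z) + card (inversions N \<sigma>) =
      (\<Sum>(i, j)\<in>P. of_bool (length_less (letter (\<sigma>, z) j) (letter (\<sigma>, z) i)) + (g i j + g j i)
         + of_bool (\<sigma> j < \<sigma> i))"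
    unfolding inv_len_def inversions_def card_P by (simp add: sum.distrib case_prod_unfold)
  also have "even \<dots>"
  proof (rule dvd_sum, clarify)
    fix i j :: nat
    assume "(i, j) \<in> P"
    then have "\<sigma> i \<noteq> \<sigma> j"
      using permutes_inj[OF \<sigma>] by (auto simp: P_def dest: injD)
    then show "even (of_bool (length_less (letter (\<sigma>, z) j) (letter (\<sigma>, z) i)) + (g i j + g j i)
         + of_bool (\<sigma> j < \<sigma> i) :: nat)"
      by (auto simp: length_less_def letter_def g_def)
  qed
  finally show ?thesis
    by simp
qed

section \<open>Exchanging two adjacent values\<close>

text \<open>
  This is the exceptional configuration in which the exchange of the values \<open>c\<close> and \<open>c + 1\<close> affects
  a comparison between neighboring letters.
\<close>

definition dominoed :: "(nat \<Rightarrow> nat) \<Rightarrow> (nat \<Rightarrow> nat) \<Rightarrow> nat \<Rightarrow> bool" where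
  "dominoed z \<sigma> c \<longleftrightarrow> (\<exists>i. {\<sigma> i, \<sigma> (Suc i)} = {c, Suc c} \<and> z i = z (Suc i))"

text \<open>
  The exchange permutes each of the pairs \<open>{d, d + 1}\<close> with \<open>d\<close> odd within itself. Therefore the
  choice of the least pair to be exchanged is the same before and after an exchange, which makes
  the exchange an involution.
\<close>

lemma dominoed_transpose_iff:
  assumes "odd c" "odd d"
  shows "dominoed z (transpose c (Suc c) \<circ> \<sigma>) d \<longleftrightarrow> dominoed z \<sigma> d"
proof -
  let ?s = "transpose c (Suc c)"
  have "?s ` {d, Suc d} = {d, Suc d}"
  proof (cases "d = c")
    case True
    then show ?thesis
      by (simp add: insert_commute)
  next
    case False
    moreover have "d \<noteq> Suc c" "Suc d \<noteq> c" "Suc d \<noteq> Suc c"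
      using assms False by auto
    ultimately show ?thesis
      by (simp add: transpose_apply_other)
  qed
  then have "{?s a, ?s b} = {d, Suc d} \<longleftrightarrow> {a, b} = {d, Suc d}" for a b
    using inj_image_eq_iff[of ?s "{a, b}" "{d, Suc d}"] by simp
  then show ?thesis
    by (simp add: dominoed_def)
qed

text \<open>
  Between neighbors of different colors, the flag order does not look at the values. Between
  neighbors of equal color, the exchange matters only if their values are exactly \<open>c\<close> and \<open>c + 1\<close>.
\<close>

lemma DesF_transpose:
  assumes "\<not> dominoed z \<sigma> c"
  shows "DesF N (transpose c (Suc c) \<circ> \<sigma>, z) = DesF N (\<sigma>, z)"
proof -
  have "flag_less (letter (transpose c (Suc c) \<circ> \<sigma>, z) (i + 1)) (letter (transpose c (Suc c) \<circ> \<sigma>, z) i)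
      \<longleftrightarrow> flag_less (letter (\<sigma>, z) (i + 1)) (letter (\<sigma>, z) i)" for i
  proof (cases "z i = z (Suc i)")
    case True
    then have "{\<sigma> (Suc i), \<sigma> i} \<noteq> {c, Suc c}"
      using assms by (auto simp: dominoed_def insert_commute)
    then show ?thesis
      using True by (simp add: flag_less_def letter_def transpose_Suc_less_iff)
  qed (auto simp: flag_less_def letter_def)
  then show ?thesis
    by (simp add: DesF_def)
qed

text \<open>
  Adjacent positions that tile an initial segment must be \<open>{1, 2}\<close>, \<open>{3, 4}\<close>, and so on: by
  induction, an odd position \<open>i\<close> cannot be the second one of its pair, because position \<open>i - 1\<close>
  already belongs to a pair with position \<open>i - 2\<close> (or does not exist).
\<close>

lemma all_dominoed_imp_blocks:
  assumes \<sigma>: "\<sigma> permutes {1..2*n}"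
    and dom: "\<And>c. c \<in> {1..2*n} \<Longrightarrow> odd c \<Longrightarrow> dominoed z \<sigma> c"
    and "i \<in> {1..2*n}" "odd i"
  shows "z i = z (Suc i) \<and> (\<exists>c. odd c \<and> {\<sigma> i, \<sigma> (Suc i)} = {c, Suc c})"
  using assms(3,4)
proof (induction i rule: less_induct)
  case (less i)
  \<comment> \<open>The value \<open>\<sigma> i\<close> belongs to the pair \<open>{c, c + 1}\<close>.\<close>
  define c where "c = (if odd (\<sigma> i) then \<sigma> i else \<sigma> i - 1)"
  have "\<sigma> i \<in> {1..2*n}"
    using permutes_in_image[OF \<sigma>] less.prems by blast
  then have c: "c \<in> {1..2*n}" "odd c" "\<sigma> i \<in> {c, Suc c}"
    by (auto simp: c_def elim!: evenE)
  from dom[OF c(1,2)] obtain j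
    where j: "{\<sigma> j, \<sigma> (Suc j)} = {c, Suc c}" "z j = z (Suc j)"
    by (auto simp: dominoed_def)
  have inj: "\<sigma> a = \<sigma> b \<longleftrightarrow> a = b" for a b
    using permutes_inj[OF \<sigma>] by (auto dest: injD)
  have "i = j \<or> i = Suc j"
    using c(3) j(1) inj by blast
  moreover have "i \<noteq> Suc j"
  proof
    assume i: "i = Suc j"
    show False
    proof (cases "j = 0")
      case True
      then have "\<sigma> j = 0"
        using permutes_not_in[OF \<sigma>, of 0] by simp
      then show False
        using j(1) c(2) by (auto simp: doubleton_eq_iff)
    next
      case False
      then obtain k where k: "j = Suc k"
        by (cases j) auto
      have "k < i" "k \<in> {1..2*n}" "odd k"
        using less.prems i k by (auto elim!: oddE)
      from less.IH[OF this] obtain d where d: "odd d" "{\<sigma> k, \<sigma> j} = {d, Suc d}"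
        by (auto simp: k)
      then have "d = c"
        using j(1) c(2) by (auto simp: doubleton_eq_iff)
      then have "\<sigma> k = \<sigma> i"
        using d j(1) i by (auto simp: doubleton_eq_iff)
      then show False
        using inj k i by simp
    qed
  qed
  ultimately show ?case
    using j c(2) by auto
qed

section \<open>Permutations of blocks of length two\<close>

text \<open>
  Block \<open>a\<close> consists of the positions \<open>2a - 1\<close> and \<open>2a\<close>, and \<open>Suc i div 2\<close> is the block of
  position \<open>i\<close>. Block \<open>a\<close> receives the values \<open>2 \<tau>(a) - 1\<close> and \<open>2 \<tau>(a)\<close>, in decreasing order if
  and only if \<open>a \<in> E\<close>.
\<close>

definition inflate :: "(nat \<Rightarrow> nat) \<Rightarrow> nat set \<Rightarrow> nat \<Rightarrow> nat" where
  "inflate \<tau> E i = (if odd i \<longleftrightarrow> Suc i div 2 \<in> E then 2 * \<tau> (Suc i div 2) else 2 * \<tau> (Suc i div 2) - 1)"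

lemma inflate_even: "a \<ge> 1 \<Longrightarrow> inflate \<tau> E (2 * a) = (if a \<in> E then 2 * \<tau> a - 1 else 2 * \<tau> a)"
  by (simp add: inflate_def)

lemma inflate_odd: "a \<ge> 1 \<Longrightarrow> inflate \<tau> E (2 * a - 1) = (if a \<in> E then 2 * \<tau> a else 2 * \<tau> a - 1)"
  by (cases a) (simp_all add: inflate_def)

lemma double_half_Suc: "2 * (Suc i div 2) = (if odd i then Suc i else i)"
  by (auto elim!: evenE oddE)

lemma half_Suc_eq: "x \<ge> 1 \<Longrightarrow> y \<in> {2 * x - 1, 2 * x} \<Longrightarrow> Suc y div 2 = x" for x y :: nat
  by auto

lemma inflate_in_pair: "inflate \<tau> E i \<in> {2 * \<tau> (Suc i div 2) - 1, 2 * \<tau> (Suc i div 2)}"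
  unfolding inflate_def by (simp only: insert_iff split: if_split) blast

lemma in_doubled_interval_cases:
  fixes i n :: nat
  assumes "i \<in> {1..2*n}"
  obtains (left) a where "a \<in> {1..n}" "i = 2 * a - 1" | (right) a where "a \<in> {1..n}" "i = 2 * a"
proof (cases "even i")
  case True
  then obtain a where "i = 2 * a" ..
  then show ?thesis
    using assms by (intro right[of a]) auto
next
  case False
  then obtain a where "i = 2 * a + 1" ..
  then show ?thesis
    using assms by (intro left[of "Suc a"]) auto
qed

lemma inflate_permutes:
  assumes \<tau>: "\<tau> permutes {1..n}" and E: "E \<subseteq> {1..n}"
  shows "inflate \<tau> E permutes {1..2*n}"
proof (rule bij_imp_permutes)
  have range: "\<tau> a \<in> {1..n}" if "a \<in> {1..n}" for a
    using permutes_in_image[OF \<tau>] that by blast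
  have half: "Suc i div 2 \<in> {1..n}" if "i \<in> {1..2*n}" for i
    using that by auto
  have inj: "\<tau> a = \<tau> b \<longleftrightarrow> a = b" for a b
    using permutes_inj[OF \<tau>] by (auto dest: injD)
  have "inj_on (inflate \<tau> E) {1..2*n}"
  proof (rule inj_onI)
    fix i j assume ij: "i \<in> {1..2*n}" "j \<in> {1..2*n}" "inflate \<tau> E i = inflate \<tau> E j"
    have block: "Suc (inflate \<tau> E k) div 2 = \<tau> (Suc k div 2)" if "k \<in> {1..2*n}" for k
      using half_Suc_eq[OF _ inflate_in_pair] range[OF half[OF that]] by simp
    have "\<tau> (Suc i div 2) = \<tau> (Suc j div 2)"
      using block[OF ij(1)] block[OF ij(2)] ij(3) by simp
    then have same: "Suc i div 2 = Suc j div 2"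
      by (simp add: inj)
    moreover have "odd i = odd j"
    proof -
      define k where "k = Suc i div 2"
      have "2 * \<tau> k - 1 \<noteq> 2 * \<tau> k"
        using range[OF half[OF ij(1)]] unfolding k_def[symmetric] by auto
      then show ?thesis
        using ij(3) unfolding inflate_def same[symmetric] k_def[symmetric] by (auto split: if_splits)
    qed
    ultimately show "i = j"
      by presburger
  qed
  moreover have "inflate \<tau> E ` {1..2*n} \<subseteq> {1..2*n}"
  proof clarify
    fix i assume "i \<in> {1..2*n}"
    have "y \<in> {1..2*n}" if "x \<in> {1..n}" "y \<in> {2 * x - 1, 2 * x}" for x y
      using that by auto
    from this[OF range[OF half[OF \<open>i \<in> {1..2*n}\<close>]] inflate_in_pair[of \<tau> E i]]
    show "inflate \<tau> E i \<in> {1..2*n}" .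
  qed
  ultimately show "bij_betw (inflate \<tau> E) {1..2*n} {1..2*n}"
    by (simp add: bij_betw_def endo_inj_surj)
next
  fix i assume i: "i \<notin> {1..2*n}"
  then have "Suc i div 2 \<notin> {1..n}"
    unfolding atLeastAtMost_iff by presburger
  define k where "k = Suc i div 2"
  have "\<tau> k = k" "k \<notin> E"
    using \<open>Suc i div 2 \<notin> {1..n}\<close> permutes_not_in[OF \<tau>] E by (auto simp: k_def)
  then show "inflate \<tau> E i = i"
    using double_half_Suc[of i] unfolding inflate_def k_def[symmetric] by (auto split: if_splits)
qed

definition block_perms :: "nat \<Rightarrow> (nat \<Rightarrow> nat) set" where
  "block_perms n = {\<sigma>. \<sigma> permutes {1..2*n} \<and>
     (\<forall>a\<in>{1..n}. \<exists>c. odd c \<and> {\<sigma> (2*a-1), \<sigma> (2*a)} = {c, Suc c})}"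

text \<open>
  Conversely, \<open>\<tau> a\<close> is the block to which the value at position \<open>2a\<close> belongs, and the order of the
  two values of block \<open>a\<close> decides whether \<open>a \<in> E\<close>.
\<close>

lemma bij_betw_inflate:
  "bij_betw (\<lambda>(\<tau>, E). inflate \<tau> E) ({\<tau>. \<tau> permutes {1..n}} \<times> Pow {1..n}) (block_perms n)"
proof (rule bij_betw_byWitness[where f' = "\<lambda>\<sigma>. (\<lambda>a. Suc (\<sigma> (2*a)) div 2, {a \<in> {1..n}. \<sigma> (2*a) < \<sigma> (2*a-1)})"])
  let ?deflate = "\<lambda>\<sigma>. (\<lambda>a. Suc (\<sigma> (2*a)) div 2, {a \<in> {1..n}. \<sigma> (2*a) < \<sigma> (2*a-1)})"
  let ?A = "{\<tau>. \<tau> permutes {1..n}} \<times> Pow {1..n}"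
  show "\<forall>p\<in>?A. ?deflate (case p of (\<tau>, E) \<Rightarrow> inflate \<tau> E) = p"
  proof
    fix p assume "p \<in> ?A"
    then obtain \<tau> E where p: "p = (\<tau>, E)" and \<tau>: "\<tau> permutes {1..n}" and E: "E \<subseteq> {1..n}"
      by auto
    have pos: "\<tau> a \<ge> 1" if "a \<in> {1..n}" for a
      using permutes_in_image[OF \<tau>, of a] that by simp
    have "Suc (inflate \<tau> E (2*a)) div 2 = \<tau> a" for a
    proof (cases "a \<in> {1..n}")
      case True
      then show ?thesis
        using pos[OF True] by (simp add: inflate_even)
    next
      case False
      then show ?thesis
        using permutes_not_in[OF \<tau> False] permutes_not_in[OF inflate_permutes[OF \<tau> E], of "2*a"]
        by simp
    qed
    moreover have "inflate \<tau> E (2*a) < inflate \<tau> E (2*a-1) \<longleftrightarrow> a \<in> E" if "a \<in> {1..n}" for a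
      using that inflate_even[of a \<tau> E] inflate_odd[of a \<tau> E] pos[OF that] by auto
    then have "{a \<in> {1..n}. inflate \<tau> E (2*a) < inflate \<tau> E (2*a-1)} = E"
      using E by blast
    ultimately show "?deflate (case p of (\<tau>, E) \<Rightarrow> inflate \<tau> E) = p"
      unfolding p prod.case prod.inject fun_eq_iff by blast
  qed
  show "(\<lambda>(\<tau>, E). inflate \<tau> E) ` ?A \<subseteq> block_perms n"
  proof clarify
    fix \<tau> E assume \<tau>: "\<tau> permutes {1..n}" and E: "E \<subseteq> {1..n}"
    have "\<exists>c. odd c \<and> {inflate \<tau> E (2*a-1), inflate \<tau> E (2*a)} = {c, Suc c}" if a: "a \<in> {1..n}" for a
    proof (intro exI conjI)
      have "\<tau> a \<ge> 1" "a \<ge> 1"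
        using permutes_in_image[OF \<tau>, of a] a by auto
      then show "odd (2 * \<tau> a - 1)"
        and "{inflate \<tau> E (2*a-1), inflate \<tau> E (2*a)} = {2 * \<tau> a - 1, Suc (2 * \<tau> a - 1)}"
        by (auto simp: inflate_even inflate_odd[simplified])
    qed
    then show "inflate \<tau> E \<in> block_perms n"
      using inflate_permutes[OF \<tau> E] by (simp add: block_perms_def)
  qed
  have block: "{\<sigma> (2*a-1), \<sigma> (2*a)} = {2 * (Suc (\<sigma> (2*a)) div 2) - 1, 2 * (Suc (\<sigma> (2*a)) div 2)}"
    "Suc (\<sigma> (2*a)) div 2 \<in> {1..n}"
    if "\<sigma> \<in> block_perms n" "a \<in> {1..n}" for \<sigma> a
  proof -
    from that obtain c where "odd c" and c: "{\<sigma> (2*a-1), \<sigma> (2*a)} = {c, Suc c}"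
      unfolding block_perms_def by blast
    then obtain k where k: "{\<sigma> (2*a-1), \<sigma> (2*a)} = {2 * Suc k - 1, 2 * Suc k}"
      by (auto elim!: oddE)
    then have "Suc (\<sigma> (2*a)) div 2 = Suc k"
      by (intro half_Suc_eq) auto
    then show "{\<sigma> (2*a-1), \<sigma> (2*a)} = {2 * (Suc (\<sigma> (2*a)) div 2) - 1, 2 * (Suc (\<sigma> (2*a)) div 2)}"
      using k by simp
    have "\<sigma> (2*a) \<in> {1..2*n}"
      using that permutes_in_image[of \<sigma> "{1..2*n}" "2*a"] by (auto simp: block_perms_def)
    then show "Suc (\<sigma> (2*a)) div 2 \<in> {1..n}"
      by auto
  qed
  show "?deflate ` block_perms n \<subseteq> ?A"
  proof (rule image_subsetI)
    fix \<sigma> assume \<sigma>: "\<sigma> \<in> block_perms n"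
    then have perm: "\<sigma> permutes {1..2*n}"
      by (simp add: block_perms_def)
    have "(\<lambda>a. Suc (\<sigma> (2*a)) div 2) permutes {1..n}"
    proof (rule bij_imp_permutes)
      have "inj_on (\<lambda>a. Suc (\<sigma> (2*a)) div 2) {1..n}"
      proof (rule inj_onI)
        fix a b assume ab: "a \<in> {1..n}" "b \<in> {1..n}" "Suc (\<sigma> (2*a)) div 2 = Suc (\<sigma> (2*b)) div 2"
        have "{\<sigma> (2*b-1), \<sigma> (2*b)} = {\<sigma> (2*a-1), \<sigma> (2*a)}"
          by (simp only: block(1)[OF \<sigma> ab(1)] block(1)[OF \<sigma> ab(2)] ab(3))
        then have "\<sigma> (2*b) \<in> {\<sigma> (2*a-1), \<sigma> (2*a)}"
          by blast
        then have "2*b = 2*a-1 \<or> 2*b = 2*a"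
          using injD[OF permutes_inj[OF perm]] by blast
        then show "a = b"
          using ab(1) unfolding atLeastAtMost_iff by presburger
      qed
      moreover have "(\<lambda>a. Suc (\<sigma> (2*a)) div 2) ` {1..n} \<subseteq> {1..n}"
        using block(2)[OF \<sigma>] by blast
      ultimately show "bij_betw (\<lambda>a. Suc (\<sigma> (2*a)) div 2) {1..n} {1..n}"
        by (simp add: bij_betw_def endo_inj_surj)
    next
      fix a assume "a \<notin> {1..n}"
      then have "2 * a \<notin> {1..2*n}"
        by auto
      then show "Suc (\<sigma> (2*a)) div 2 = a"
        using permutes_not_in[OF perm] by simp
    qed
    then show "?deflate \<sigma> \<in> ?A"
      by blast
  qed
  show "\<forall>\<sigma>\<in>block_perms n. (case ?deflate \<sigma> of (\<tau>, E) \<Rightarrow> inflate \<tau> E) = \<sigma>"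
  proof
    fix \<sigma> assume \<sigma>: "\<sigma> \<in> block_perms n"
    let ?\<tau> = "\<lambda>a. Suc (\<sigma> (2*a)) div 2" and ?E = "{a \<in> {1..n}. \<sigma> (2*a) < \<sigma> (2*a-1)}"
    have perm: "\<sigma> permutes {1..2*n}"
      using \<sigma> by (simp add: block_perms_def)
    have "inflate ?\<tau> ?E i = \<sigma> i" for i
    proof (cases "i \<in> {1..2*n}")
      case True
      then show ?thesis
      proof (cases rule: in_doubled_interval_cases)
        case (left a)
        define m where "m = Suc (\<sigma> (2*a)) div 2"
        have "inflate ?\<tau> ?E (2*a-1) = (if \<sigma> (2*a) < \<sigma> (2*a-1) then 2 * m else 2 * m - 1)"
          using inflate_odd[of a ?\<tau> ?E] left(1) by (simp add: m_def)
        also have "\<dots> = \<sigma> (2*a-1)"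
          using block[OF \<sigma> left(1)] unfolding m_def[symmetric] by (auto simp: doubleton_eq_iff)
        finally show ?thesis
          using left(2) by simp
      next
        case (right a)
        define m where "m = Suc (\<sigma> (2*a)) div 2"
        have "inflate ?\<tau> ?E (2*a) = (if \<sigma> (2*a) < \<sigma> (2*a-1) then 2 * m - 1 else 2 * m)"
          using inflate_even[of a ?\<tau> ?E] right(1) by (simp add: m_def)
        also have "\<dots> = \<sigma> (2*a)"
          using block[OF \<sigma> right(1)] unfolding m_def[symmetric] by (auto simp: doubleton_eq_iff)
        finally show ?thesis
          using right(2) by simp
      qed
    next
      case False
      define k where "k = Suc i div 2"
      have "k \<notin> {1..n}"
        using False unfolding k_def atLeastAtMost_iff by presburger
      then have "k \<notin> ?E" "\<sigma> (2*k) = 2*k"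
        using permutes_not_in[OF perm, of "2*k"] by auto
      then show ?thesis
        using permutes_not_in[OF perm False] double_half_Suc[of i]
        unfolding inflate_def k_def[symmetric] by (auto split: if_splits)
    qed
    then show "(case ?deflate \<sigma> of (\<tau>, E) \<Rightarrow> inflate \<tau> E) = \<sigma>"
      unfolding prod.case by (rule ext)
  qed
qed

text \<open>
  Inversions within a block come from \<open>E\<close>. For two different blocks, all four pairs of positions
  are inversions or none is, as \<open>\<tau>\<close> decides. In the proof, the positions of block \<open>a\<close> are
  written as \<open>2a - d\<close> with \<open>d \<in> {0, 1}\<close>.
\<close>

lemma card_inversions_inflate:
  assumes \<tau>: "\<tau> permutes {1..n}" and E: "E \<subseteq> {1..n}"
  shows "card (inversions (2*n) (inflate \<tau> E)) = card E + 4 * card (inversions n \<tau>)"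
proof -
  let ?inner = "(\<lambda>a. (2*a-1, 2*a)) ` E"
  let ?f = "\<lambda>((a, b), (d, e)). (2*a-d, 2*b-e)"
  let ?C = "inversions n \<tau> \<times> ({0, 1} \<times> {0, 1 :: nat})"
  let ?I = "inflate \<tau> E"
  have range: "\<tau> a \<in> {1..n}" if "a \<in> {1..n}" for a
    using permutes_in_image[OF \<tau>] that by blast
  have inj: "\<tau> a = \<tau> b \<longleftrightarrow> a = b" for a b
    using permutes_inj[OF \<tau>] by (auto dest: injD)
  have val: "\<exists>e\<in>{0,1}. ?I (2*a-d) = 2 * \<tau> a - e" if "a \<in> {1..n}" "d \<in> {0,1}" for a d
    using that inflate_even[of a \<tau> E] inflate_odd[of a \<tau> E] by auto
  have less: "?I (2*b-e) < ?I (2*a-d) \<longleftrightarrow> \<tau> b < \<tau> a"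
    if "a \<in> {1..n}" "b \<in> {1..n}" "d \<in> {0,1}" "e \<in> {0,1}" "a \<noteq> b" for a b d e
  proof -
    from val[OF that(1,3)] val[OF that(2,4)] obtain d' e'
      where "d' \<in> {0,1}" "e' \<in> {0,1}" "?I (2*a-d) = 2 * \<tau> a - d'" "?I (2*b-e) = 2 * \<tau> b - e'"
      by blast
    moreover have "\<tau> a \<noteq> \<tau> b" "\<tau> a \<ge> 1" "\<tau> b \<ge> 1"
      using inj range that by auto
    ultimately show ?thesis
      by auto
  qed
  have inner: "?I (2*a) < ?I (2*a-1) \<longleftrightarrow> a \<in> E" if "a \<in> {1..n}" for a
    using that inflate_even[of a \<tau> E] inflate_odd[of a \<tau> E] range[OF that] by auto
  have "inversions (2*n) ?I = ?inner \<union> ?f ` ?C"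
  proof (intro equalityI subsetI)
    fix p assume p: "p \<in> inversions (2*n) ?I"
    obtain i j where p_eq: "p = (i, j)"
      by (cases p)
    have ij: "i \<in> {1..2*n}" "j \<in> {1..2*n}" "i < j" "?I j < ?I i"
      using p by (auto simp: p_eq inversions_def)
    have split: "\<exists>a\<in>{1..n}. \<exists>d\<in>{0,1}. k = 2*a-d" if "k \<in> {1..2*n}" for k
      using that by (cases rule: in_doubled_interval_cases) force+
    from split[OF ij(1)] split[OF ij(2)] obtain a b d e
      where ab: "a \<in> {1..n}" "b \<in> {1..n}" "d \<in> {0,1}" "e \<in> {0,1}" "i = 2*a-d" "j = 2*b-e"
      by blast
    show "p \<in> ?inner \<union> ?f ` ?C"
    proof (cases "a = b")
      case True
      then have "d = 1" "e = 0"
        using ab ij(3) by auto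
      then have "a \<in> E" "p = (2*a-1, 2*a)"
        using ij(4) ab inner[OF ab(1)] True p_eq by auto
      then show ?thesis
        by blast
    next
      case False
      then have "a < b"
        using ab ij(3) by auto
      moreover have "\<tau> b < \<tau> a"
        using less[OF ab(1-4) False] ij(4) ab(5,6) by simp
      ultimately have "((a, b), (d, e)) \<in> ?C"
        using ab(1-4) by (auto simp: inversions_def)
      then have "?f ((a, b), (d, e)) \<in> ?f ` ?C"
        by (rule imageI)
      then show ?thesis
        using ab(5,6) p_eq by simp
    qed
  next
    fix p assume "p \<in> ?inner \<union> ?f ` ?C"
    then show "p \<in> inversions (2*n) ?I"
    proof
      assume "p \<in> ?inner"
      then obtain a where "a \<in> E" "p = (2*a-1, 2*a)"
        by blast
      moreover from this have "a \<in> {1..n}"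
        using E by blast
      ultimately show ?thesis
        using inner[of a] by (auto simp: inversions_def)
    next
      assume "p \<in> ?f ` ?C"
      then obtain a b d e where abde: "(a, b) \<in> inversions n \<tau>" "d \<in> {0,1}" "e \<in> {0,1}"
        and p: "p = (2*a-d, 2*b-e)"
        by force
      then have ab: "a \<in> {1..n}" "b \<in> {1..n}" "a < b" "\<tau> b < \<tau> a"
        by (auto simp: inversions_def)
      then have "?I (2*b-e) < ?I (2*a-d)"
        using less[OF ab(1,2) abde(2,3)] by simp
      moreover have "2*a-d < 2*b-e" "2*a-d \<in> {1..2*n}" "2*b-e \<in> {1..2*n}"
        using ab abde(2,3) by auto
      ultimately show ?thesis
        by (simp add: inversions_def p)
    qed
  qed
  moreover have "?inner \<inter> ?f ` ?C = {}"
  proof -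
    have "x \<notin> ?f ` ?C" if x: "x \<in> ?inner" for x
    proof
      assume "x \<in> ?f ` ?C"
      then obtain a b d e where "(a, b) \<in> inversions n \<tau>" "d \<in> {0,1}" "e \<in> {0,1}"
        and "x = (2*a-d, 2*b-e)"
        by force
      moreover from this have "a < b" "a \<ge> 1"
        by (auto simp: inversions_def)
      moreover obtain k where "x = (2*k-1, 2*k)" "k \<in> E"
        using x by blast
      moreover have "k \<ge> 1"
        using E \<open>k \<in> E\<close> by auto
      ultimately have "a = k \<and> b = k"
        by auto
      then show False
        using \<open>a < b\<close> by simp
    qed
    then show ?thesis
      by blast
  qed
  moreover have "inj_on ?f ?C"
  proof (rule inj_onI)
    fix p p' assume pp: "p \<in> ?C" "p' \<in> ?C" "?f p = ?f p'"
    obtain a b d e a' b' d' e' where eqs: "p = ((a, b), (d, e))" "p' = ((a', b'), (d', e'))"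
      by (metis surj_pair)
    have halves: "u = v \<and> s = t" if "2*u-s = 2*v-t" "u \<ge> 1" "v \<ge> 1" "s \<in> {0,1}" "t \<in> {0,1}"
      for u v s t :: nat
      using that by auto presburger+
    have "a = a' \<and> d = d'"
      by (rule halves) (use pp in \<open>auto simp: eqs inversions_def\<close>)
    moreover have "b = b' \<and> e = e'"
      by (rule halves) (use pp in \<open>auto simp: eqs inversions_def\<close>)
    ultimately show "p = p'"
      unfolding eqs by simp
  qed
  moreover have "inj_on (\<lambda>a. (2*a-1, 2*a)) E"
    by (rule inj_onI) simp
  moreover have "finite E"
    using E finite_subset by blast
  ultimately show ?thesis
    by (simp add: card_Un_disjoint card_image card_cartesian_product)
qed

lemma DesF_inflate:
  assumes \<tau>: "\<tau> permutes {1..n}" and E: "E \<subseteq> {1..n}" and z: "\<And>a. a \<in> {1..n} \<Longrightarrow> z (2*a-1) = z (2*a)"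
  shows "DesF (2*n) (inflate \<tau> E, z) = (\<lambda>a. 2*a-1) ` E \<union> (\<lambda>a. 2*a) ` DesF n (\<tau>, \<lambda>a. z (2*a))"
proof -
  let ?I = "inflate \<tau> E"
  have range: "\<tau> a \<in> {1..n}" if "a \<in> {1..n}" for a
    using permutes_in_image[OF \<tau>] that by blast
  have odd_des: "2*a-1 \<in> DesF (2*n) (?I, z) \<longleftrightarrow> a \<in> E" if a: "a \<in> {1..n}" for a
    using that inflate_even[of a \<tau> E] inflate_odd[of a \<tau> E] range[OF that] z[OF that]
    by (auto simp: DesF_def flag_less_def letter_def)
  have even_des: "2*a \<in> DesF (2*n) (?I, z) \<longleftrightarrow> a \<in> DesF n (\<tau>, \<lambda>a. z (2*a))" if a: "a \<in> {1..n}" for a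
  proof (cases "a = n")
    case True
    then show ?thesis
      using a by (auto simp: DesF_def)
  next
    case False
    then have a': "Suc a \<in> {1..n}"
      using a by auto
    have "\<tau> a \<noteq> \<tau> (Suc a)"
      using permutes_inj[OF \<tau>] by (metis injD n_not_Suc_n)
    moreover have "?I (Suc (2*a)) \<in> {2 * \<tau> (Suc a), 2 * \<tau> (Suc a) - 1}"
      using inflate_odd[of "Suc a" \<tau> E] by auto
    moreover have "?I (2*a) \<in> {2 * \<tau> a, 2 * \<tau> a - 1}"
      using inflate_even[of a \<tau> E] a by auto
    moreover have "y < x \<longleftrightarrow> v < u"
      if "x \<in> {2 * u, 2 * u - 1}" "y \<in> {2 * v, 2 * v - 1}" "u \<noteq> v" "u \<in> {1..n}" "v \<in> {1..n}"
      for x y u v :: nat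
      using that by auto
    ultimately have "?I (Suc (2*a)) < ?I (2*a) \<longleftrightarrow> \<tau> (Suc a) < \<tau> a"
      using range[OF a] range[OF a'] by blast
    then show ?thesis
      using a a' z[OF a'] by (auto simp: DesF_def flag_less_def letter_def)
  qed
  show ?thesis
  proof (intro equalityI subsetI)
    fix i assume i: "i \<in> DesF (2*n) (?I, z)"
    then have "i \<in> {1..2*n}"
      by (auto simp: DesF_def)
    then show "i \<in> (\<lambda>a. 2*a-1) ` E \<union> (\<lambda>a. 2*a) ` DesF n (\<tau>, \<lambda>a. z (2*a))"
      by (cases rule: in_doubled_interval_cases) (use i odd_des even_des in blast)+
  next
    fix i assume "i \<in> (\<lambda>a. 2*a-1) ` E \<union> (\<lambda>a. 2*a) ` DesF n (\<tau>, \<lambda>a. z (2*a))"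
    moreover have "DesF n (\<tau>, \<lambda>a. z (2*a)) \<subseteq> {1..n}"
      by (auto simp: DesF_def)
    ultimately show "i \<in> DesF (2*n) (?I, z)"
      using E odd_des even_des by blast
  qed
qed

section \<open>The signed sum over descent sets\<close>

text \<open>
  The involution exchanges the values \<open>c\<close> and \<open>c + 1\<close> for the least odd \<open>c\<close> whose exchange
  preserves the descent set.
\<close>

lemma sum_not_all_dominoed_eq_0:
  fixes w :: "nat \<Rightarrow> 'a :: comm_ring_1"
  shows "(\<Sum>\<sigma> | \<sigma> permutes {1..2*n} \<and> \<not> (\<forall>c\<in>{1..2*n}. odd c \<longrightarrow> dominoed z \<sigma> c).
    (-1) ^ card (inversions (2*n) \<sigma>) * prod w (DesF (2*n) (\<sigma>, z))) = 0"
proof -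
  define bad where "bad \<sigma> = {c \<in> {1..2*n}. odd c \<and> \<not> dominoed z \<sigma> c}" for \<sigma>
  define m where "m \<sigma> = Min (bad \<sigma>)" for \<sigma>
  define f where "f \<sigma> = transpose (m \<sigma>) (Suc (m \<sigma>)) \<circ> \<sigma>" for \<sigma> :: "nat \<Rightarrow> nat"
  define B where "B = {\<sigma>. \<sigma> permutes {1..2*n} \<and> bad \<sigma> \<noteq> {}}"
  have B_eq: "{\<sigma>. \<sigma> permutes {1..2*n} \<and> \<not> (\<forall>c\<in>{1..2*n}. odd c \<longrightarrow> dominoed z \<sigma> c)} = B"
    unfolding B_def bad_def by blast
  have perm: "\<sigma> permutes {1..2*n}" if "\<sigma> \<in> B" for \<sigma>
    using that by (simp add: B_def)
  have m: "m \<sigma> \<in> bad \<sigma>" if "\<sigma> \<in> B" for \<sigma>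
    unfolding m_def using that by (intro Min_in) (auto simp: B_def bad_def)
  have m': "m \<sigma> \<in> {1..2*n}" "odd (m \<sigma>)" "\<not> dominoed z \<sigma> (m \<sigma>)" "Suc (m \<sigma>) \<in> {1..2*n}" if "\<sigma> \<in> B" for \<sigma>
  proof -
    show range: "m \<sigma> \<in> {1..2*n}" and odd: "odd (m \<sigma>)" and "\<not> dominoed z \<sigma> (m \<sigma>)"
      using m[OF that] by (simp_all add: bad_def)
    have "Suc c \<in> {1..2*n}" if "c \<in> {1..2*n}" "odd c" for c
      using that unfolding atLeastAtMost_iff by presburger
    from this[OF range odd] show "Suc (m \<sigma>) \<in> {1..2*n}" .
  qed
  have bad_f: "bad (f \<sigma>) = bad \<sigma>" if "\<sigma> \<in> B" for \<sigma>
    using dominoed_transpose_iff[OF m'(2)[OF that]] by (auto simp: bad_def f_def)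
  show ?thesis
    unfolding B_eq
  proof (rule sum_involution_eq_0[where h = f])
    fix \<sigma> assume \<sigma>: "\<sigma> \<in> B"
    show "(-1) ^ card (inversions (2*n) (f \<sigma>)) * prod w (DesF (2*n) (f \<sigma>, z))
        + (-1) ^ card (inversions (2*n) \<sigma>) * prod w (DesF (2*n) (\<sigma>, z)) = 0"
      unfolding f_def DesF_transpose[OF m'(3)[OF \<sigma>]]
        neg_one_power_inversions_transpose[OF perm[OF \<sigma>] m'(1,4)[OF \<sigma>]]
      by simp
    have "f \<sigma> permutes {1..2*n}"
      unfolding f_def by (intro permutes_compose perm[OF \<sigma>] permutes_swap_id m'[OF \<sigma>])
    then show "f \<sigma> \<in> B"
      using bad_f[OF \<sigma>] \<sigma> by (simp add: B_def)
    have "m (f \<sigma>) = m \<sigma>"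
      by (simp add: m_def bad_f[OF \<sigma>])
    then show "f (f \<sigma>) = \<sigma>"
      unfolding f_def[of "f \<sigma>"] by (simp add: f_def fun_eq_iff)
    \<comment> \<open>The two permutations differ at the position where \<open>\<sigma>\<close> has the value \<open>m \<sigma>\<close>.\<close>
    have "f \<sigma> (inv \<sigma> (m \<sigma>)) = Suc (m \<sigma>)" "\<sigma> (inv \<sigma> (m \<sigma>)) = m \<sigma>"
      using permutes_inverses(1)[OF perm[OF \<sigma>]] by (simp_all add: f_def)
    then show "f \<sigma> \<noteq> \<sigma>"
      by force
  qed
qed

lemma all_dominoed_eq_block_perms:
  "{\<sigma>. \<sigma> permutes {1..2*n} \<and> (\<forall>c\<in>{1..2*n}. odd c \<longrightarrow> dominoed z \<sigma> c)} =
    (if \<forall>a\<in>{1..n}. z (2*a-1) = z (2*a) then block_perms n else {})"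
proof -
  let ?D = "{\<sigma>. \<sigma> permutes {1..2*n} \<and> (\<forall>c\<in>{1..2*n}. odd c \<longrightarrow> dominoed z \<sigma> c)}"
  have D: "z (2*a-1) = z (2*a) \<and> (\<exists>c. odd c \<and> {\<sigma> (2*a-1), \<sigma> (2*a)} = {c, Suc c})"
    if "\<sigma> \<in> ?D" "a \<in> {1..n}" for \<sigma> a
  proof -
    have "2*a-1 \<in> {1..2*n}" "odd (2*a-1)" "Suc (2*a-1) = 2*a"
      using that(2) by auto
    then show ?thesis
      using all_dominoed_imp_blocks[of \<sigma> n z "2*a-1"] that(1) by auto
  qed
  show ?thesis
  proof (cases "\<forall>a\<in>{1..n}. z (2*a-1) = z (2*a)")
    case True
    have "block_perms n \<subseteq> ?D"
    proof
      fix \<sigma> assume \<sigma>: "\<sigma> \<in> block_perms n"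
      then have perm: "\<sigma> permutes {1..2*n}"
        by (simp add: block_perms_def)
      have "dominoed z \<sigma> c" if c: "c \<in> {1..2*n}" "odd c" for c
      proof -
        have pos: "inv \<sigma> c \<in> {1..2*n}" and val: "\<sigma> (inv \<sigma> c) = c"
          using permutes_in_image[OF permutes_inv[OF perm]] permutes_inverses(1)[OF perm] c by auto
        from pos obtain a where a: "a \<in> {1..n}" "inv \<sigma> c \<in> {2*a-1, 2*a}"
          by (cases rule: in_doubled_interval_cases) auto
        from \<sigma> a(1) obtain d where d: "odd d" "{\<sigma> (2*a-1), \<sigma> (2*a)} = {d, Suc d}"
          unfolding block_perms_def by blast
        have "c \<in> {d, Suc d}"
          using a(2) val d(2) by (metis insert_iff singletonD)
        with d(1) c(2) have "c = d"
          by auto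
        moreover have "Suc (2*a-1) = 2*a"
          using a(1) by simp
        ultimately show ?thesis
          unfolding dominoed_def using d(2) True a(1) by (intro exI[of _ "2*a-1"]) simp
      qed
      with perm show "\<sigma> \<in> ?D"
        by blast
    qed
    moreover have "?D \<subseteq> block_perms n"
      using D unfolding block_perms_def by blast
    ultimately have "?D = block_perms n"
      by blast
    then show ?thesis
      using True by simp
  next
    case False
    then have "?D = {}"
      using D by blast
    then show ?thesis
      unfolding if_not_P[OF False] .
  qed
qed

text \<open>
  The weight of a block permutation is a product of a factor that depends on \<open>E\<close> and a factor that
  depends on \<open>\<tau>\<close>, since \<open>E\<close> decides about the odd descents and \<open>\<tau>\<close> about the even ones.
\<close>

lemma sum_block_perms:
  fixes w :: "nat \<Rightarrow> 'a :: comm_ring_1"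
  assumes z: "\<And>a. a \<in> {1..n} \<Longrightarrow> z (2*a-1) = z (2*a)"
  shows "(\<Sum>\<sigma>\<in>block_perms n. (-1) ^ card (inversions (2*n) \<sigma>) * prod w (DesF (2*n) (\<sigma>, z))) =
    (\<Prod>i=1..n. 1 - w (2*i-1)) *
    (\<Sum>\<tau> | \<tau> permutes {1..n}. \<Prod>i\<in>DesF n (\<tau>, \<lambda>i. z (2*i)). w (2*i))"
proof -
  let ?wt = "\<lambda>\<sigma>. (-1) ^ card (inversions (2*n) \<sigma>) * prod w (DesF (2*n) (\<sigma>, z))"
  let ?P = "{\<tau>. \<tau> permutes {1..n}}"
  let ?v = "\<lambda>\<tau>. \<Prod>i\<in>DesF n (\<tau>, \<lambda>i. z (2*i)). w (2*i)"
  have weight: "?wt (inflate \<tau> E) = (-1) ^ card E * (\<Prod>i\<in>E. w (2*i-1)) * ?v \<tau>"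
    if \<tau>: "\<tau> permutes {1..n}" and E: "E \<subseteq> {1..n}" for \<tau> E
  proof -
    let ?D = "DesF n (\<tau>, \<lambda>i. z (2*i))"
    have "finite E" "finite ?D"
      using finite_subset[OF E] by (simp_all add: DesF_def)
    moreover have "(\<lambda>a. 2*a-1) ` E \<inter> (\<lambda>a. 2*a) ` ?D = {}"
    proof -
      have "2*a-1 \<noteq> 2*b" if "a \<in> E" for a b :: nat
      proof -
        have "a \<ge> 1"
          using that E by auto
        then show ?thesis
          by presburger
      qed
      then show ?thesis
        by blast
    qed
    moreover have "DesF (2*n) (inflate \<tau> E, z) = (\<lambda>a. 2*a-1) ` E \<union> (\<lambda>a. 2*a) ` ?D"
      using \<tau> E z by (rule DesF_inflate)
    ultimately have "prod w (DesF (2*n) (inflate \<tau> E, z)) =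
        prod w ((\<lambda>a. 2*a-1) ` E) * prod w ((\<lambda>a. 2*a) ` ?D)"
      by (simp only: prod.union_disjoint finite_imageI)
    also have "prod w ((\<lambda>a. 2*a-1) ` E) = (\<Prod>i\<in>E. w (2*i-1))"
    proof (subst prod.reindex)
      show "inj_on (\<lambda>a. 2*a-1) E"
      proof (rule inj_onI)
        fix a b assume "a \<in> E" "b \<in> E" "2*a-1 = 2*b-1"
        moreover from this have "a \<ge> 1" "b \<ge> 1"
          using E by auto
        ultimately show "a = b"
          by presburger
      qed
    qed simp
    also have "prod w ((\<lambda>a. 2*a) ` ?D) = ?v \<tau>"
      by (subst prod.reindex) (auto intro: inj_onI)
    moreover have "(-1 :: 'a) ^ card (inversions (2*n) (inflate \<tau> E)) = (-1) ^ card E"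
      unfolding card_inversions_inflate[OF \<tau> E] by (simp add: power_add power_mult)
    ultimately show ?thesis
      by (simp add: mult.assoc)
  qed
  have "(\<Sum>\<sigma>\<in>block_perms n. ?wt \<sigma>) =
      (\<Sum>p\<in>?P \<times> Pow {1..n}. ?wt ((\<lambda>(\<tau>, E). inflate \<tau> E) p))"
    by (rule sum.reindex_bij_betw[OF bij_betw_inflate, symmetric])
  also have "\<dots> = (\<Sum>(\<tau>, E)\<in>?P \<times> Pow {1..n}. ?v \<tau> * ((-1) ^ card E * (\<Prod>i\<in>E. w (2*i-1))))"
  proof (rule sum.cong[OF refl])
    fix p assume p: "p \<in> ?P \<times> Pow {1..n}"
    obtain \<tau> E where "p = (\<tau>, E)"
      by (cases p)
    with p show "?wt ((\<lambda>(\<tau>, E). inflate \<tau> E) p)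
        = (case p of (\<tau>, E) \<Rightarrow> ?v \<tau> * ((-1) ^ card E * (\<Prod>i\<in>E. w (2*i-1))))"
      using weight[of \<tau> E] by (simp add: mult.commute)
  qed
  also have "\<dots> = (\<Sum>\<tau>\<in>?P. ?v \<tau>) * (\<Sum>E\<in>Pow {1..n}. (-1) ^ card E * (\<Prod>i\<in>E. w (2*i-1)))"
    by (simp only: sum.cartesian_product[symmetric] sum_product)
  also have "(\<Sum>E\<in>Pow {1..n}. (-1) ^ card E * (\<Prod>i\<in>E. w (2*i-1))) = (\<Prod>i=1..n. 1 - w (2*i-1))"
    by (simp add: prod_diff_conv_sum)
  finally show ?thesis
    by (simp only: mult.commute)
qed

text \<open>
  Both halves of the argument meet here: the permutations outside of \<open>block_perms n\<close>, or all of
  them if the colors do not agree in pairs, cancel, and \<open>sum_block_perms\<close> evaluates the rest.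
\<close>

theorem signed_descent_sum:
  fixes w :: "nat \<Rightarrow> 'a :: comm_ring_1"
  shows "(\<Sum>\<sigma> | \<sigma> permutes {1..2*n}. (-1) ^ card (inversions (2*n) \<sigma>) * prod w (DesF (2*n) (\<sigma>, z))) =
    (if \<forall>a\<in>{1..n}. z (2*a-1) = z (2*a) then
       (\<Prod>i=1..n. 1 - w (2*i-1)) *
       (\<Sum>\<tau> | \<tau> permutes {1..n}. \<Prod>i\<in>DesF n (\<tau>, \<lambda>i. z (2*i)). w (2*i))
     else 0)"
proof -
  let ?A = "{\<sigma>. \<sigma> permutes {1..2*n}}"
  let ?D = "{\<sigma>. \<sigma> permutes {1..2*n} \<and> (\<forall>c\<in>{1..2*n}. odd c \<longrightarrow> dominoed z \<sigma> c)}"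
  let ?B = "{\<sigma>. \<sigma> permutes {1..2*n} \<and> \<not> (\<forall>c\<in>{1..2*n}. odd c \<longrightarrow> dominoed z \<sigma> c)}"
  let ?wt = "\<lambda>\<sigma>. (-1) ^ card (inversions (2*n) \<sigma>) * prod w (DesF (2*n) (\<sigma>, z))"
  have "?A = ?B \<union> ?D" "?B \<inter> ?D = {}"
    by blast+
  moreover have "finite ?A"
    by (rule finite_permutations) simp
  ultimately have "sum ?wt ?A = sum ?wt ?B + sum ?wt ?D"
    by (metis (no_types, lifting) finite_Un sum.union_disjoint)
  also have "sum ?wt ?B = 0"
    by (rule sum_not_all_dominoed_eq_0)
  finally show ?thesis
    using sum_block_perms[of n z w] unfolding all_dominoed_eq_block_perms by auto
qed

section \<open>Summation over the colors\<close>

lemma restricted_colored_perms_eq_Times: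
  assumes "\<And>i. i \<in> {1..N} \<Longrightarrow> H i \<subseteq> {..<r}"
  shows "restricted_colored_perms r N H = {\<sigma>. \<sigma> permutes {1..N}} \<times> Pi\<^sub>E {1..N} H"
proof -
  have "z \<in> {1..N} \<rightarrow>\<^sub>E {..<r} \<and> (\<forall>i\<in>{1..N}. z i \<in> H i) \<longleftrightarrow> z \<in> Pi\<^sub>E {1..N} H" for z
    using assms by (force simp: PiE_iff)
  then show ?thesis
    unfolding restricted_colored_perms_def colored_perms_def by blast
qed

lemma colored_perms_eq_restricted: "colored_perms r N = restricted_colored_perms r N (\<lambda>_. {..<r})"
  by (auto simp: restricted_colored_perms_def colored_perms_def)

lemma DesF_cong:
  assumes "\<And>i. i \<in> {1..N} \<Longrightarrow> z i = z' i"
  shows "DesF N (\<sigma>, z) = DesF N (\<sigma>, z')"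
proof -
  have "z i = z' i \<and> z (i + 1) = z' (i + 1)" if "i \<in> {1..N-1}" for i
    using assms that by auto
  then show ?thesis
    by (auto simp: DesF_def letter_def)
qed

lemma sum_doubled: "(\<Sum>i=1..2*n. f i) = (\<Sum>i=1..n. f (2*i-1) + f (2*i))"
  for f :: "nat \<Rightarrow> 'a :: comm_monoid_add"
  by (induction n) (simp_all add: add.assoc)

lemma prod_doubled: "(\<Prod>i=1..2*n. f i) = (\<Prod>i=1..n. f (2*i-1) * f (2*i))"
  for f :: "nat \<Rightarrow> 'a :: comm_monoid_mult"
  by (induction n) (simp_all add: mult.assoc)

lemma prod_power_descents:
  fixes t v :: "'a :: comm_ring_1"
  shows "(\<Prod>i\<in>D. t ^ r * v ^ (r * i)) = t ^ (r * card D) * v ^ (r * \<Sum>D)"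
  by (simp add: prod.distrib power_mult power_sum[symmetric] sum_distrib_left[symmetric])

lemma doubled_color_apply:
  assumes "a \<in> {1..n}"
  shows "(\<lambda>i\<in>{1..2*n}. y (Suc i div 2)) (2*a-1) = y a"
    and "(\<lambda>i\<in>{1..2*n}. y (Suc i div 2)) (2*a) = y a"
proof -
  have "2*a-1 \<in> {1..2*n}" "2*a \<in> {1..2*n}" "Suc (2*a-1) div 2 = a" "Suc (2*a) div 2 = a"
    using assms by auto
  then show "(\<lambda>i\<in>{1..2*n}. y (Suc i div 2)) (2*a-1) = y a"
    and "(\<lambda>i\<in>{1..2*n}. y (Suc i div 2)) (2*a) = y a"
    by (simp_all only: restrict_apply if_True)
qed

text \<open>
  A color vector of length \<open>2n\<close> that is constant on each block arises from a color vector of length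
  \<open>n\<close> by repeating each entry. A repeated color must be admissible at both positions of its block,
  hence the intersections.
\<close>

lemma bij_betw_double_colors:
  assumes S: "\<And>i. i \<in> {1..n} \<Longrightarrow> S i = H (2*i-1) \<inter> H (2*i)"
  shows "bij_betw (\<lambda>y. \<lambda>i\<in>{1..2*n}. y (Suc i div 2)) (Pi\<^sub>E {1..n} S)
    {z \<in> Pi\<^sub>E {1..2*n} H. \<forall>a\<in>{1..n}. z (2*a-1) = z (2*a)}"
proof (rule bij_betw_byWitness[where f' = "\<lambda>z. \<lambda>a\<in>{1..n}. z (2*a)"])
  let ?double = "\<lambda>y. \<lambda>i\<in>{1..2*n}. y (Suc i div 2)" and ?halve = "\<lambda>z. \<lambda>a\<in>{1..n}. z (2*a)"
  let ?M = "{z \<in> Pi\<^sub>E {1..2*n} H. \<forall>a\<in>{1..n}. z (2*a-1) = z (2*a)}"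
  show "\<forall>y\<in>Pi\<^sub>E {1..n} S. ?halve (?double y) = y"
  proof
    fix y assume y: "y \<in> Pi\<^sub>E {1..n} S"
    have "?halve (?double y) a = y a" for a
    proof (cases "a \<in> {1..n}")
      case True
      then show ?thesis
        unfolding restrict_apply'[OF True] by (rule doubled_color_apply)
    next
      case False
      then show ?thesis
        using PiE_arb[OF y False] by (simp only: restrict_apply if_False)
    qed
    then show "?halve (?double y) = y"
      by (rule ext)
  qed
  show "\<forall>z\<in>?M. ?double (?halve z) = z"
  proof
    fix z assume z: "z \<in> ?M"
    have "?double (?halve z) i = z i" for i
    proof (cases "i \<in> {1..2*n}")
      case True
      then show ?thesis
      proof (cases rule: in_doubled_interval_cases)
        case (left a)
        have "z (2*a-1) = z (2*a)"
          using z left(1) by blast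
        then show ?thesis
          unfolding left(2) doubled_color_apply(1)[OF left(1)] restrict_apply'[OF left(1)] by (rule sym)
      next
        case (right a)
        show ?thesis
          unfolding right(2) doubled_color_apply(2)[OF right(1)] restrict_apply'[OF right(1)] ..
      qed
    next
      case False
      have "z \<in> Pi\<^sub>E {1..2*n} H"
        using z by blast
      from PiE_arb[OF this False] show ?thesis
        using False by (simp only: restrict_apply if_False)
    qed
    then show "?double (?halve z) = z"
      by (rule ext)
  qed
  show "?double ` Pi\<^sub>E {1..n} S \<subseteq> ?M"
  proof (rule image_subsetI)
    fix y assume y: "y \<in> Pi\<^sub>E {1..n} S"
    have "?double y i \<in> H i" if "i \<in> {1..2*n}" for i
      using that
    proof (cases rule: in_doubled_interval_cases)
      case (left a)
      have "y a \<in> H (2*a-1)"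
        using PiE_mem[OF y left(1)] S[OF left(1)] by blast
      then show ?thesis
        unfolding left(2) doubled_color_apply(1)[OF left(1)] .
    next
      case (right a)
      have "y a \<in> H (2*a)"
        using PiE_mem[OF y right(1)] S[OF right(1)] by blast
      then show ?thesis
        unfolding right(2) doubled_color_apply(2)[OF right(1)] .
    qed
    then have "?double y \<in> Pi\<^sub>E {1..2*n} H"
      by (intro PiE_I) (auto simp del: atLeastAtMost_iff)
    moreover have "\<forall>a\<in>{1..n}. ?double y (2*a-1) = ?double y (2*a)"
      by (intro ballI) (simp only: doubled_color_apply)
    ultimately show "?double y \<in> ?M"
      by (intro CollectI conjI)
  qed
  show "?halve ` ?M \<subseteq> Pi\<^sub>E {1..n} S"
  proof (rule image_subsetI)
    fix z assume "z \<in> ?M"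
    then have z: "z \<in> Pi\<^sub>E {1..2*n} H" "\<And>a. a \<in> {1..n} \<Longrightarrow> z (2*a-1) = z (2*a)"
      by auto
    show "?halve z \<in> Pi\<^sub>E {1..n} S"
    proof (rule PiE_I)
      fix a assume a: "a \<in> {1..n}"
      then have "2*a-1 \<in> {1..2*n}" "2*a \<in> {1..2*n}"
        by auto
      then have "z (2*a-1) \<in> H (2*a-1)" "z (2*a) \<in> H (2*a)"
        using PiE_mem[OF z(1)] by blast+
      then show "?halve z a \<in> S a"
        unfolding restrict_apply'[OF a] S[OF a] using z(2)[OF a] by simp
    qed (simp only: restrict_apply if_False)
  qed
qed

text \<open>
  For \<open>v = \<omega>\<^sup>b q\<close> this contains both parts of the theorem: \<open>x i\<close> is \<open>x\<^sub>i\<close> in the first one and the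
  same indeterminate for all \<open>i\<close> in the second one. The descents have the weights
  \<open>w i = t ^ r * v ^ (r * i)\<close>, and \<open>w (2 * i)\<close> is what \<open>w i\<close> becomes when \<open>v\<close> is replaced by its
  square; this is why the flag major index is doubled on the right-hand side.
\<close>

lemma signed_flag_sum:
  fixes t v :: "'a :: comm_ring_1" and x :: "nat \<Rightarrow> 'a"
  assumes n: "n \<ge> 1"
    and H: "\<And>i. i \<in> {1..2*n} \<Longrightarrow> H i \<subseteq> {..<r}"
    and S: "\<And>i. i \<in> {1..n} \<Longrightarrow> S i = H (2*i-1) \<inter> H (2*i)"
  shows "(\<Sum>\<pi>\<in>restricted_colored_perms r (2*n) H.
      (-1) ^ (len (2*n) \<pi> - col (2*n) \<pi>) * t ^ fdes r (2*n) \<pi> * v ^ fmaj r (2*n) \<pi>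
      * (\<Prod>i=1..2*n. x i ^ color \<pi> i)) =
    (\<Prod>i=1..n. 1 - t ^ r * v ^ (r * (2*i-1))) *
    (\<Sum>\<pi>\<in>restricted_colored_perms r n S.
      t ^ fdes r n \<pi> * v ^ (2 * fmaj r n \<pi>) * (\<Prod>i=1..n. (x (2*i-1) * x (2*i)) ^ color \<pi> i))"
proof -
  let ?P2 = "{\<sigma>. \<sigma> permutes {1..2*n}}" and ?P = "{\<tau>. \<tau> permutes {1..n}}"
  let ?M = "{z \<in> Pi\<^sub>E {1..2*n} H. \<forall>a\<in>{1..n}. z (2*a-1) = z (2*a)}"
  define w where "w i = t ^ r * v ^ (r * i)" for i
  \<comment> \<open>The part of the summand that depends on the colors only.\<close>
  define u where "u z = t ^ z 1 * v ^ (\<Sum>i=1..2*n. z i) * (\<Prod>i=1..2*n. x i ^ z i)" for z :: "nat \<Rightarrow> nat"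
  define K where "K = (\<Prod>i=1..n. 1 - w (2*i-1))"
  define F where "F y = (\<Sum>\<tau>\<in>?P. \<Prod>i\<in>DesF n (\<tau>, y). w (2*i))" for y
  let ?double = "\<lambda>y. \<lambda>i\<in>{1..2*n}. y (Suc i div 2) :: nat"
  have S_sub: "S i \<subseteq> {..<r}" if "i \<in> {1..n}" for i
  proof -
    have "2*i \<in> {1..2*n}"
      using that by auto
    from H[OF this] S[OF that] show ?thesis
      by blast
  qed
  have fin: "finite (Pi\<^sub>E {1..2*n} H)"
    by (intro finite_PiE finite_subset[OF H finite_lessThan]) simp_all
  have Times2: "restricted_colored_perms r (2*n) H = ?P2 \<times> Pi\<^sub>E {1..2*n} H"
    using H by (rule restricted_colored_perms_eq_Times)
  have Times: "restricted_colored_perms r n S = ?P \<times> Pi\<^sub>E {1..n} S"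
    using S_sub by (rule restricted_colored_perms_eq_Times)
  have bij: "bij_betw ?double (Pi\<^sub>E {1..n} S) ?M"
    using S by (rule bij_betw_double_colors)
  have weight2: "(-1) ^ (len (2*n) (\<sigma>, z) - col (2*n) (\<sigma>, z)) * t ^ fdes r (2*n) (\<sigma>, z)
      * v ^ fmaj r (2*n) (\<sigma>, z) * (\<Prod>i=1..2*n. x i ^ color (\<sigma>, z) i)
    = (-1) ^ card (inversions (2*n) \<sigma>) * prod w (DesF (2*n) (\<sigma>, z)) * u z"
    if "\<sigma> permutes {1..2*n}" for \<sigma> z
  proof -
    have sign: "(-1 :: 'a) ^ (len (2*n) (\<sigma>, z) - col (2*n) (\<sigma>, z)) = (-1) ^ card (inversions (2*n) \<sigma>)"
      using even_len_minus_col_iff[OF that, of z] by (simp add: minus_one_power_iff)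
    have des: "prod w (DesF (2*n) (\<sigma>, z)) = t ^ (r * desF (2*n) (\<sigma>, z)) * v ^ (r * majF (2*n) (\<sigma>, z))"
      unfolding w_def desF_def majF_def by (rule prod_power_descents)
    show ?thesis
      unfolding sign des by (simp add: u_def fdes_def fmaj_def col_def color_def power_add mult_ac)
  qed
  have u_double: "u (?double y) = t ^ y 1 * v ^ (2 * (\<Sum>i=1..n. y i)) * (\<Prod>i=1..n. (x (2*i-1) * x (2*i)) ^ y i)" for y
  proof -
    have "?double y 1 = y 1"
      using doubled_color_apply(1)[of 1 n y] n by simp
    moreover have "(\<Sum>i=1..2*n. ?double y i) = 2 * (\<Sum>i=1..n. y i)"
      unfolding sum_doubled sum_distrib_left by (rule sum.cong[OF refl]) (simp only: doubled_color_apply mult_2[of "y _"])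
    moreover have "(\<Prod>i=1..2*n. x i ^ ?double y i) = (\<Prod>i=1..n. (x (2*i-1) * x (2*i)) ^ y i)"
      unfolding prod_doubled by (rule prod.cong[OF refl]) (simp only: doubled_color_apply power_mult_distrib)
    ultimately show ?thesis
      unfolding u_def by (simp only:)
  qed
  have weight: "t ^ fdes r n (\<tau>, y) * v ^ (2 * fmaj r n (\<tau>, y)) * (\<Prod>i=1..n. (x (2*i-1) * x (2*i)) ^ color (\<tau>, y) i)
    = (\<Prod>i\<in>DesF n (\<tau>, y). w (2*i)) * u (?double y)" for \<tau> y
  proof -
    have "w (2*i) = t ^ r * (v ^ 2) ^ (r * i)" for i
      by (simp add: w_def power_mult[symmetric] mult_ac)
    then have "(\<Prod>i\<in>DesF n (\<tau>, y). w (2*i)) = t ^ (r * desF n (\<tau>, y)) * v ^ (2 * (r * majF n (\<tau>, y)))"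
      unfolding desF_def majF_def power_mult[of v 2] by (simp only: prod_power_descents)
    then show ?thesis
      unfolding u_double by (simp add: fdes_def fmaj_def col_def color_def power_add distrib_left mult_ac)
  qed
  have "(\<Sum>\<pi>\<in>restricted_colored_perms r (2*n) H.
      (-1) ^ (len (2*n) \<pi> - col (2*n) \<pi>) * t ^ fdes r (2*n) \<pi> * v ^ fmaj r (2*n) \<pi>
      * (\<Prod>i=1..2*n. x i ^ color \<pi> i)) =
    (\<Sum>\<sigma>\<in>?P2. \<Sum>z\<in>Pi\<^sub>E {1..2*n} H. (-1) ^ card (inversions (2*n) \<sigma>) * prod w (DesF (2*n) (\<sigma>, z)) * u z)"
    unfolding Times2 sum.cartesian_product
    by (rule sum.cong[OF refl]) (auto simp: weight2 simp del: One_nat_def)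
  also have "\<dots> = (\<Sum>z\<in>Pi\<^sub>E {1..2*n} H.
      (\<Sum>\<sigma>\<in>?P2. (-1) ^ card (inversions (2*n) \<sigma>) * prod w (DesF (2*n) (\<sigma>, z))) * u z)"
    unfolding sum_distrib_right by (rule sum.swap)
  also have "\<dots> = (\<Sum>z\<in>Pi\<^sub>E {1..2*n} H.
      if \<forall>a\<in>{1..n}. z (2*a-1) = z (2*a) then K * F (\<lambda>i. z (2*i)) * u z else 0)"
    unfolding signed_descent_sum K_def F_def by (rule sum.cong[OF refl]) simp
  also have "\<dots> = (\<Sum>z\<in>?M. K * F (\<lambda>i. z (2*i)) * u z)"
    using fin by (rule sum.inter_filter[symmetric])
  also have "\<dots> = (\<Sum>y\<in>Pi\<^sub>E {1..n} S. K * F (\<lambda>i. ?double y (2*i)) * u (?double y))"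
    by (rule sum.reindex_bij_betw[OF bij, symmetric])
  also have "\<dots> = (\<Sum>y\<in>Pi\<^sub>E {1..n} S. K * (F y * u (?double y)))"
  proof (rule sum.cong[OF refl])
    fix y
    have "DesF n (\<tau>, \<lambda>i. ?double y (2*i)) = DesF n (\<tau>, y)" for \<tau>
      by (rule DesF_cong) (rule doubled_color_apply)
    then show "K * F (\<lambda>i. ?double y (2*i)) * u (?double y) = K * (F y * u (?double y))"
      unfolding F_def by (simp only: mult.assoc)
  qed
  also have "\<dots> = K * (\<Sum>\<tau>\<in>?P. \<Sum>y\<in>Pi\<^sub>E {1..n} S. (\<Prod>i\<in>DesF n (\<tau>, y). w (2*i)) * u (?double y))"
    unfolding F_def sum_distrib_left[symmetric] sum_distrib_right by (subst sum.swap) (rule refl)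
  also have "\<dots> = K * (\<Sum>\<pi>\<in>restricted_colored_perms r n S.
      t ^ fdes r n \<pi> * v ^ (2 * fmaj r n \<pi>) * (\<Prod>i=1..n. (x (2*i-1) * x (2*i)) ^ color \<pi> i))"
    unfolding Times sum.cartesian_product
    by (intro arg_cong[of _ _ "(*) K"] sum.cong[OF refl]) (auto simp: weight simp del: One_nat_def)
  finally show ?thesis
    unfolding K_def w_def .
qed

section \<open>Specialization to the polynomial ring\<close>

lemma Const_mult: "Const (a * b) = Const a * Const b"
  by (simp add: Const_def mult_single)

lemma Const_power: "Const (a ^ k) = Const a ^ k"
  by (induction k) (simp_all add: Const_mult, simp add: Const_def)

lemma Const_neg_one: "Const (- 1) = - 1"
  by (simp add: Const_def single_uminus)

text \<open>
  Modulo \<open>r\<close>, the flag major index is the color sum. Hence the factor \<open>\<omega>\<close> to the power \<open>b col\<close> of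
  the character turns \<open>q\<close> into \<open>\<omega>\<^sup>b q\<close>. The factors \<open>s\<close> and \<open>p\<close> give the equation the shape
  of the summands in the theorem, so that it can be used for rewriting.
\<close>

lemma Const_chi_fmaj:
  assumes "\<omega> ^ r = 1"
  shows "Const (chi \<omega> N 1 b \<pi>) * s * Var Q ^ fmaj r N \<pi> * p =
    (-1) ^ (len N \<pi> - col N \<pi>) * s * (Const (\<omega> ^ b) * Var Q) ^ fmaj r N \<pi> * p"
proof -
  have "Const (\<omega> ^ b) ^ fmaj r N \<pi> = Const (\<omega> ^ (b * col N \<pi>))"
  proof -
    have "\<omega> ^ (b * fmaj r N \<pi>) = (\<omega> ^ r) ^ (b * majF N \<pi>) * \<omega> ^ (b * col N \<pi>)"
      by (simp add: fmaj_def distrib_left power_add power_mult[symmetric] mult_ac)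
    then show ?thesis
      using assms by (simp add: Const_power[symmetric] power_mult)
  qed
  then show ?thesis
    by (simp add: chi_def Const_mult Const_power Const_neg_one power_mult_distrib mult_ac)
qed

theorem theorem2p3:
  fixes r n b :: nat and \<omega> :: complex
  assumes "r \<ge> 1" and "n \<ge> 1"
    and "primitive_root_of_1 r \<omega>"
    and "b \<le> r - 1"
  shows
    "(\<forall>H S :: nat \<Rightarrow> nat set.
        (\<forall>i\<in>{1..2*n}. H i \<noteq> {} \<and> H i \<subseteq> {..<r}) \<longrightarrow>
        (\<forall>i\<in>{1..n}. S i = H (2*i-1) \<inter> H (2*i)) \<longrightarrow>
        (\<Sum>\<pi>\<in>restricted_colored_perms r (2*n) H.
            Const (chi \<omega> (2*n) 1 b \<pi>) * Var T ^ fdes r (2*n) \<pi> * Var Q ^ fmaj r (2*n) \<pi>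
            * (\<Prod>i=1..2*n. Var (Xi i) ^ color \<pi> i))
        = (\<Prod>i=1..n. 1 - Var T ^ r * Var Q ^ (r * (2*i-1)))
          * (\<Sum>\<pi>\<in>restricted_colored_perms r n S.
              Var T ^ fdes r n \<pi> * (Const (\<omega> ^ b) * Var Q) ^ (2 * fmaj r n \<pi>)
              * (\<Prod>i=1..n. (Var (Xi (2*i-1)) * Var (Xi (2*i))) ^ color \<pi> i)))
     \<and>
     (\<Sum>\<pi>\<in>colored_perms r (2*n).
         Const (chi \<omega> (2*n) 1 b \<pi>) * Var T ^ fdes r (2*n) \<pi> * Var Q ^ fmaj r (2*n) \<pi>
         * Var X ^ col (2*n) \<pi>)
     = (\<Prod>i=1..n. 1 - Var T ^ r * Var Q ^ (r * (2*i-1)))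
       * (\<Sum>\<pi>\<in>colored_perms r n.
           Var T ^ fdes r n \<pi> * (Const (\<omega> ^ b) * Var Q) ^ (2 * fmaj r n \<pi>)
           * Var X ^ (2 * col n \<pi>))"
proof (intro conjI allI impI)
  let ?v = "Const (\<omega> ^ b) * Var Q"
  have root: "\<omega> ^ r = 1"
    using assms(3) by (simp add: primitive_root_of_1_def)
  have "Const (\<omega> ^ b) ^ r = 1"
    using root by (simp add: Const_power[symmetric] power_mult[symmetric] mult.commute[of b r])
      (simp add: power_mult Const_def)
  then have absorb: "?v ^ (r * k) = Var Q ^ (r * k)" for k
    by (simp add: power_mult_distrib power_mult)
  {
    fix H S :: "nat \<Rightarrow> nat set"
    assume "\<forall>i\<in>{1..2*n}. H i \<noteq> {} \<and> H i \<subseteq> {..<r}" and "\<forall>i\<in>{1..n}. S i = H (2*i-1) \<inter> H (2*i)"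
    then show "(\<Sum>\<pi>\<in>restricted_colored_perms r (2*n) H.
            Const (chi \<omega> (2*n) 1 b \<pi>) * Var T ^ fdes r (2*n) \<pi> * Var Q ^ fmaj r (2*n) \<pi>
            * (\<Prod>i=1..2*n. Var (Xi i) ^ color \<pi> i))
        = (\<Prod>i=1..n. 1 - Var T ^ r * Var Q ^ (r * (2*i-1)))
          * (\<Sum>\<pi>\<in>restricted_colored_perms r n S.
              Var T ^ fdes r n \<pi> * ?v ^ (2 * fmaj r n \<pi>)
              * (\<Prod>i=1..n. (Var (Xi (2*i-1)) * Var (Xi (2*i))) ^ color \<pi> i))"
      unfolding Const_chi_fmaj[OF root] absorb[symmetric]
      by (intro signed_flag_sum assms(2)) blast+
  }
  have "Var X ^ col (2*n) \<pi> = (\<Prod>i=1..2*n. Var X ^ color \<pi> i)" for \<pi>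
    by (simp add: col_def power_sum)
  moreover have "Var X ^ (2 * col n \<pi>) = (\<Prod>i=1..n. (Var X * Var X) ^ color \<pi> i)" for \<pi>
    by (simp add: col_def power_sum power_mult power2_eq_square)
  ultimately show "(\<Sum>\<pi>\<in>colored_perms r (2*n).
         Const (chi \<omega> (2*n) 1 b \<pi>) * Var T ^ fdes r (2*n) \<pi> * Var Q ^ fmaj r (2*n) \<pi>
         * Var X ^ col (2*n) \<pi>)
     = (\<Prod>i=1..n. 1 - Var T ^ r * Var Q ^ (r * (2*i-1)))
       * (\<Sum>\<pi>\<in>colored_perms r n.
           Var T ^ fdes r n \<pi> * ?v ^ (2 * fmaj r n \<pi>) * Var X ^ (2 * col n \<pi>))"
    unfolding Const_chi_fmaj[OF root] absorb[symmetric] colored_perms_eq_restricted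
    by (simp only:) (intro signed_flag_sum assms(2); blast)
qed

end
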